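(* Let $m\ge 1$, $p,s\ge 1$, and let $a_1,\dots,a_p$ (minuends) and $b_1,\dots,b_s$ (subtrahends) be nonnegative integers, each at most $10^m-1$. Starting from the empty yupana with $m$ rows, load the minuends with positive tokens and the subtrahends with negative tokens, in any (possibly intermixed) order, and then execute any finite sequence of table movements, in any order, ending in a state that is simple. Then the number shown by this final simple state equals $(a_1+\cdots+a_p)-(b_1+\cdots+b_s)$.
   Context: **Board and states.** A yupana with $m$ rows is the board whose set of squares is $C=\{5,3,2,1\}\times\{0,1,\dots,m-1\}$; the square $(b,r)$ has weight $b$ and lies in row $r$. There are two colors of tokens, positive and negative. A state assigns to each square $(b,r)$ a number $N^+_{b,r}\in\mathbb{Z}_{\ge 0}$ of positive tokens and a number $N^-_{b,r}\in\mathbb{Z}_{\ge 0}$ of negative tokens. The effective value of a square is $E_{b,r}=(N^+_{b,r}-N^-_{b,r})\,b\,10^r$, and the value of the yupana is $\sum_{(b,r)\in C}E_{b,r}$. **Representation of digits.** A decimal digit is represented in a row by placing one token on each of the following squares of that row (listed by weight) and none on the others: $0$: none; $1$: $\{1\}$; $2$: $\{2\}$; $3$: $\{3\}$; $4$: $\{3,1\}$; $5$: $\{5\}$; $6$: $\{5,1\}$; $7$: $\{5,2\}$; $8$: $\{5,3\}$; $9$: $\{5,3,1\}$. **Loading.** Loading a number $a$ with $0\le a\le 10^m-1$ and decimal digits $d_{m-1}\cdots d_1d_0$, with tokens of a given color, means adding to the current state, for each $r$, tokens of that color representing the digit $d_r$ in row $r$. **Simple state.** A state is simple if all its tokens have a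 single color and each row $r$ represents some digit $d_r\in\{0,\dots,9\}$, meaning that row $r$ has exactly one token on each square whose weight belongs to the set $S(d_r)$ and no token on its other squares, where $S(0)=\emptyset$, $S(1)=\{1\}$, $S(2)=\{2\}$, $S(3)=\{3\}$, $S(4)=\{3,1\}$, $S(5)=\{5\}$, $S(6)=\{5,1\}$, $S(7)=\{5,2\}$, $S(8)=\{5,3\}$, $S(9)=\{5,3,1\}$. The number shown by it is $\sum_r d_r10^r$ if the tokens are positive (or there are none), and $-\sum_r d_r10^r$ if they are negative. **Table movements.** Each movement below is available for every integer $k\ge1$ and row $r$ for which the tokens to be removed are present and all squares mentioned exist. Except for Chinkay, all tokens removed and placed in one movement have the same color (either one). Write $c\,[b]_r$ for $c$ tokens on square $(b,r)$; $X\to Y$ means remove $X$ and place $Y$. - Reducing: $2k[2]_r\to k[1]_r+k[3]_r$ (Iskay); $2k[3]_r\to k[1]_r+k[5]_r$ (Kimsa); $2k[5]_r\to k[1]_{r+1}$ (Pisqa); $2k[1]_r\to k[2]_r$, $3k[1]_r\to k[3]_r$, $5k[1]_r\to k[5]_r$ (Kikin); $k[1]_r+k[2]_r\to k[3]_r$, $k[2]_r+k[3]_r\to k[5]_r$ (Pichana). - Expansion: $k[5]_r\to k[3]_r+k[2]_r$; $k[3]_r\to k[2]_r+k[1]_r$; $k[2]_r\to 2k[1]_r$; $k[1]_{r+1}\to 2k[5]_r$; $k[1]_{r+1}\to k[5]_r+k[3]_r+k[2]_r$; $k[1]_{r+1}\to 2k[3]_r+2k[2]_r$; $k[1]_{r+1}\to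 k[3]_r+2k[2]_r+3k[1]_r$. - Composite: for $b\in\{5,3,2,1\}$ and $n\ge1$, $10^n[b]_r\to 1[b]_{r+n}$ (Chunka, etc.); $2k[2]_r+2k[3]_r\to k[1]_{r+1}$ (Sonqo); $k[5]_r+k[3]_r+k[2]_r\to k[1]_{r+1}$ (Hatun Pichana); $2k[3]_r+k[2]_r+2k[1]_r\to k[1]_{r+1}$ (Paña Chaska); $k[3]_r+2k[2]_r+3k[1]_r\to k[1]_{r+1}$ (Huq-Iskay-Kimsa); $3k[3]_r+k[1]_r\to k[1]_{r+1}$ (K'usillu). - Chinkay: remove $k$ positive and $k$ negative tokens from one square. *)

theory Defs
  imports Main "HOL-Library.Multiset"
begin

text \<open>A square is a pair of its weight and its row.\<close>

type_synonym square = "nat \<times> nat"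

definition weights :: "nat set" where
  "weights = {5, 3, 2, 1}"

definition squares :: "nat \<Rightarrow> square set" where
  "squares m = weights \<times> {..<m}"

datatype color = Positive | Negative

text \<open>
  A state gives, for each color, the multiset of occupied squares: the number of tokens of
  color \<open>c\<close> on the square \<open>(b, r)\<close> is \<open>count (st c) (b, r)\<close>. The number of rows is not part of
  the type; loading and movements place tokens on \<open>squares m\<close> only, so every state reachable
  from the empty one lives on the board.
\<close>

type_synonym state = "color \<Rightarrow> square multiset"

definition empty_state :: state where
  "empty_state = (\<lambda>_. {#})"

text \<open>The weights that carry a token in the representation of a digit; meaningful for \<open>d \<le> 9\<close> only.\<close>

definition digit_weights :: "nat \<Rightarrow> nat set" where
  "digit_weights d =
    [{}, {1}, {2}, {3}, {3, 1}, {5}, {5, 1}, {5, 2}, {5, 3}, {5, 3, 1}] ! d"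

definition decimal_digit :: "nat \<Rightarrow> nat \<Rightarrow> nat" where
  "decimal_digit a r = a div 10 ^ r mod 10"

definition number_tokens :: "nat \<Rightarrow> nat \<Rightarrow> square multiset" where
  "number_tokens m a = (\<Sum>r<m. mset_set (digit_weights (decimal_digit a r) \<times> {r}))"

definition load :: "nat \<Rightarrow> color \<Rightarrow> nat \<Rightarrow> state \<Rightarrow> state" where
  "load m c a st = st(c := st c + number_tokens m a)"

definition load_all :: "nat \<Rightarrow> (color \<times> nat) list \<Rightarrow> state \<Rightarrow> state" where
  "load_all m ops st = fold (\<lambda>(c, a). load m c a) ops st"

definition row_represents :: "square multiset \<Rightarrow> nat \<Rightarrow> nat \<Rightarrow> bool" where
  "row_represents T r d \<longleftrightarrow>
    d \<le> 9 \<and> (\<forall>b\<in>weights. count T (b, r) = (if b \<in> digit_weights d then 1 else 0))"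

definition simple :: "nat \<Rightarrow> state \<Rightarrow> bool" where
  "simple m st \<longleftrightarrow>
    (\<exists>c. (\<forall>c'. c' \<noteq> c \<longrightarrow> st c' = {#}) \<and> (\<forall>r<m. \<exists>d. row_represents (st c) r d))"

text \<open>
  The digit of a row is unique whenever it exists, so the definite descriptions below are
  well defined for simple states.
\<close>

definition row_digit :: "square multiset \<Rightarrow> nat \<Rightarrow> nat" where
  "row_digit T r = (THE d. row_represents T r d)"

definition number_shown :: "nat \<Rightarrow> state \<Rightarrow> int" where
  "number_shown m st =
    (if st Negative = {#} then (\<Sum>r<m. int (row_digit (st Positive) r) * 10 ^ r)
     else - (\<Sum>r<m. int (row_digit (st Negative) r) * 10 ^ r))"

abbreviation tok :: "nat \<Rightarrow> nat \<Rightarrow> nat \<Rightarrow> square multiset" where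
  "tok n b r \<equiv> replicate_mset n (b, r)"

text \<open>
  \<open>exchange X Y\<close>: the movement removing \<open>X\<close> and placing \<open>Y\<close>, all tokens being of one color.
  Whether the squares exist and the tokens are present is checked in \<open>movement\<close>.
\<close>

inductive exchange :: "square multiset \<Rightarrow> square multiset \<Rightarrow> bool" where
  iskay: "k \<ge> 1 \<Longrightarrow> exchange (tok (2*k) 2 r) (tok k 1 r + tok k 3 r)"
| kimsa: "k \<ge> 1 \<Longrightarrow> exchange (tok (2*k) 3 r) (tok k 1 r + tok k 5 r)"
| pisqa: "k \<ge> 1 \<Longrightarrow> exchange (tok (2*k) 5 r) (tok k 1 (r+1))"
| kikin2: "k \<ge> 1 \<Longrightarrow> exchange (tok (2*k) 1 r) (tok k 2 r)"
| kikin3: "k \<ge> 1 \<Longrightarrow> exchange (tok (3*k) 1 r) (tok k 3 r)"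
| kikin5: "k \<ge> 1 \<Longrightarrow> exchange (tok (5*k) 1 r) (tok k 5 r)"
| pichana3: "k \<ge> 1 \<Longrightarrow> exchange (tok k 1 r + tok k 2 r) (tok k 3 r)"
| pichana5: "k \<ge> 1 \<Longrightarrow> exchange (tok k 2 r + tok k 3 r) (tok k 5 r)"
| expand5: "k \<ge> 1 \<Longrightarrow> exchange (tok k 5 r) (tok k 3 r + tok k 2 r)"
| expand3: "k \<ge> 1 \<Longrightarrow> exchange (tok k 3 r) (tok k 2 r + tok k 1 r)"
| expand2: "k \<ge> 1 \<Longrightarrow> exchange (tok k 2 r) (tok (2*k) 1 r)"
| expand10_55: "k \<ge> 1 \<Longrightarrow> exchange (tok k 1 (r+1)) (tok (2*k) 5 r)"
| expand10_532: "k \<ge> 1 \<Longrightarrow> exchange (tok k 1 (r+1)) (tok k 5 r + tok k 3 r + tok k 2 r)"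
| expand10_3322: "k \<ge> 1 \<Longrightarrow> exchange (tok k 1 (r+1)) (tok (2*k) 3 r + tok (2*k) 2 r)"
| expand10_322111:
    "k \<ge> 1 \<Longrightarrow> exchange (tok k 1 (r+1)) (tok k 3 r + tok (2*k) 2 r + tok (3*k) 1 r)"
| chunka: "b \<in> weights \<Longrightarrow> n \<ge> 1 \<Longrightarrow> exchange (tok (10 ^ n) b r) (tok 1 b (r+n))"
| sonqo: "k \<ge> 1 \<Longrightarrow> exchange (tok (2*k) 2 r + tok (2*k) 3 r) (tok k 1 (r+1))"
| hatun_pichana: "k \<ge> 1 \<Longrightarrow> exchange (tok k 5 r + tok k 3 r + tok k 2 r) (tok k 1 (r+1))"
| pana_chaska:
    "k \<ge> 1 \<Longrightarrow> exchange (tok (2*k) 3 r + tok k 2 r + tok (2*k) 1 r) (tok k 1 (r+1))"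
| huq_iskay_kimsa:
    "k \<ge> 1 \<Longrightarrow> exchange (tok k 3 r + tok (2*k) 2 r + tok (3*k) 1 r) (tok k 1 (r+1))"
| kusillu: "k \<ge> 1 \<Longrightarrow> exchange (tok (3*k) 3 r + tok k 1 r) (tok k 1 (r+1))"

inductive movement :: "nat \<Rightarrow> state \<Rightarrow> state \<Rightarrow> bool" for m where
  exchange:
    "exchange X Y \<Longrightarrow> set_mset X \<union> set_mset Y \<subseteq> squares m \<Longrightarrow> X \<subseteq># st c
      \<Longrightarrow> movement m st (st(c := st c - X + Y))"
| chinkay:
    "k \<ge> 1 \<Longrightarrow> q \<in> squares m
      \<Longrightarrow> replicate_mset k q \<subseteq># st Positive \<Longrightarrow> replicate_mset k q \<subseteq># st Negative
      \<Longrightarrow> movement m st (\<lambda>c. st c - replicate_mset k q)"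

end

theory Submission imports Defs begin

text \<open>
  Every table movement preserves the value of the yupana, and loading changes it by the loaded
  number. On a simple state the value is the number shown, because the weights representing a
  digit add up to that digit.
\<close>

section \<open>Value of token multisets and its conservation under movements\<close>

definition tokens_value :: "square multiset \<Rightarrow> int" where
  "tokens_value T = (\<Sum>(b, r)\<in>#T. int b * 10 ^ r)"

text \<open>The sum of all effective values, regrouped by color.\<close>

definition state_value :: "state \<Rightarrow> int" where
  "state_value st = tokens_value (st Positive) - tokens_value (st Negative)"

text \<open>The type \<open>state\<close> also allows tokens outside the board. They would count in
  \<open>state_value\<close> but stay invisible to \<open>number_shown\<close>, which reads only the
  rows below \<open>m\<close>; hence this second invariant.\<close>

definition on_board :: "nat \<Rightarrow> state \<Rightarrow> bool" where
  "on_board m st \<longleftrightarrow> (\<forall>c. set_mset (st c) \<subseteq> squares m)"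

fun signed :: "color \<times> nat \<Rightarrow> int" where
  "signed (Positive, a) = int a"
| "signed (Negative, a) = - int a"

lemma sum_list_int: "(\<Sum>x\<leftarrow>xs. int x) = int (sum_list xs)"
  by (induction xs) simp_all

lemma sum_list_uminus: "(\<Sum>x\<leftarrow>xs. - int x) = - int (sum_list xs)"
  by (induction xs) simp_all

lemma tokens_value_empty [simp]: "tokens_value {#} = 0"
  by (simp add: tokens_value_def)

lemma tokens_value_union [simp]: "tokens_value (S + T) = tokens_value S + tokens_value T"
  by (simp add: tokens_value_def)

text \<open>Multiset subtraction truncates; the inclusion makes \<open>T\<close> the sum of
  \<open>T - S\<close> and \<open>S\<close>, so additivity applies.\<close>

lemma tokens_value_diff: "S \<subseteq># T \<Longrightarrow> tokens_value (T - S) = tokens_value T - tokens_value S"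
  by (metis add_diff_cancel_right' subset_mset.diff_add tokens_value_union)

lemma tokens_value_replicate [simp]:
  "tokens_value (replicate_mset n (b, r)) = int n * int b * 10 ^ r"
  by (induction n) (simp_all add: tokens_value_def algebra_simps)

lemma tokens_value_single: "tokens_value {#(b, r)#} = int b * 10 ^ r"
  by (simp add: tokens_value_def)

lemma tokens_value_sum: "tokens_value (sum f A) = (\<Sum>x\<in>A. tokens_value (f x))"
  by (induction A rule: infinite_finite_induct) simp_all

lemma tokens_value_mset_set_row:
  "finite B \<Longrightarrow> tokens_value (mset_set (B \<times> {r})) = int (\<Sum>B) * 10 ^ r"
proof -
  assume "finite B"
  have "tokens_value (mset_set (B \<times> {r})) = (\<Sum>(b, r)\<in>B \<times> {r}. int b * 10 ^ r)"
    by (simp add: tokens_value_def sum_unfold_sum_mset)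
  also have "\<dots> = (\<Sum>b\<in>B. int b * 10 ^ r)"
    using \<open>finite B\<close> by (simp flip: sum.cartesian_product)
  finally show ?thesis
    by (simp add: sum_distrib_right)
qed

text \<open>Each rule reduces to an identity between weights, such as 2*2 = 1 + 3 or 3 + 2*2 + 3*1 =
  10, a token of weight 1 one row up counting as 10. For \<open>chunka\<close> the identity is 10^n
  * 10^r = 10^(r+n).\<close>

lemma exchange_value: "exchange X Y \<Longrightarrow> tokens_value X = tokens_value Y"
  by (induction rule: exchange.induct) (simp_all add: tokens_value_single power_add)

text \<open>An exchange trades equal values within one color. Chinkay takes the same multiset from
  both colors, so the two losses cancel in the difference.\<close>

lemma movement_value: "movement m st st' \<Longrightarrow> state_value st' = state_value st"
proof (induction rule: movement.induct)
  case (exchange X Y st c)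
  then show ?case
    by (cases c) (simp_all add: state_value_def tokens_value_diff exchange_value
        del: subset_mset.add_diff_assoc2)
next
  case (chinkay k q st)
  then show ?case
    by (simp add: state_value_def tokens_value_diff)
qed

lemma movement_on_board: "movement m st st' \<Longrightarrow> on_board m st \<Longrightarrow> on_board m st'"
  by (induction rule: movement.induct) (fastforce simp: on_board_def dest: in_diffD split: if_splits)+

lemma movements_invariant:
  "(movement m)\<^sup>*\<^sup>* st st' \<Longrightarrow> on_board m st
    \<Longrightarrow> on_board m st' \<and> state_value st' = state_value st"
  by (induction rule: rtranclp_induct) (auto simp: movement_value movement_on_board)

section \<open>Digits, rows and simple states\<close>

lemma le_9_cases:
  "d \<le> 9 \<Longrightarrow> d \<in> {0, 1, 2, 3, 4, 5, 6, 7, 8, 9 :: nat}"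
  by auto

lemma digit_weights_subset: "d \<le> 9 \<Longrightarrow> digit_weights d \<subseteq> weights"
  by (drule le_9_cases) (auto simp: digit_weights_def weights_def)

lemma finite_weights [simp]: "finite weights"
  by (simp add: weights_def)

lemma finite_digit_weights: "d \<le> 9 \<Longrightarrow> finite (digit_weights d)"
  using digit_weights_subset finite_subset finite_weights by blast

lemma sum_digit_weights: "d \<le> 9 \<Longrightarrow> \<Sum>(digit_weights d) = d"
  by (drule le_9_cases) (auto simp: digit_weights_def)

text \<open>The counts in a row determine the set of occupied weights, and the digit is recovered as
  the sum of that set.\<close>

lemma row_represents_unique:
  assumes "row_represents T r d" "row_represents T r e"
  shows "d = e"
proof -
  have "b \<in> digit_weights d \<longleftrightarrow> b \<in> digit_weights e" if "b \<in> weights" for b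
    using assms that unfolding row_represents_def by (metis zero_neq_one)
  then have "digit_weights d = digit_weights e"
    using assms digit_weights_subset unfolding row_represents_def by blast
  then show ?thesis
    using assms sum_digit_weights unfolding row_represents_def by metis
qed

lemma row_represents_row_digit:
  "row_represents T r d \<Longrightarrow> row_represents T r (row_digit T r)"
  unfolding row_digit_def by (rule theI) (auto intro: row_represents_unique)

lemma row_represents_value:
  assumes "row_represents T r d"
  shows "(\<Sum>b\<in>weights. count T (b, r) * b) = d"
proof -
  have d: "d \<le> 9"
    and cnt: "\<And>b. b \<in> weights \<Longrightarrow> count T (b, r) = (if b \<in> digit_weights d then 1 else 0)"
    using assms by (auto simp: row_represents_def)
  have "(\<Sum>b\<in>weights. count T (b, r) * b) = (\<Sum>b\<in>weights. if b \<in> digit_weights d then b else 0)"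
    by (intro sum.cong) (simp_all add: cnt)
  also have "\<dots> = \<Sum>(weights \<inter> digit_weights d)"
    by (simp add: sum.inter_restrict)
  also have "\<dots> = d"
    using d by (simp add: digit_weights_subset sum_digit_weights Int_absorb1)
  finally show ?thesis .
qed

text \<open>Elements of \<open>A\<close> outside \<open>T\<close> have count 0, so the index set can
  be fixed in advance. Taking all squares of the board allows summation row by row.\<close>

lemma sum_mset_eq_sum_count:
  fixes f :: "'a \<Rightarrow> int"
  shows "finite A \<Longrightarrow> set_mset T \<subseteq> A \<Longrightarrow> (\<Sum>x\<in>#T. f x) = (\<Sum>x\<in>A. int (count T x) * f x)"
proof (induction T)
  case (add y T)
  have "(\<Sum>x\<in>A. int (count (add_mset y T) x) * f x)
      = (\<Sum>x\<in>A. int (count T x) * f x + (if x = y then f x else 0))"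
    by (intro sum.cong) (auto simp: algebra_simps)
  also have "\<dots> = (\<Sum>x\<in>A. int (count T x) * f x) + f y"
    using add.prems by (simp add: sum.distrib)
  finally show ?case
    using add by simp
qed simp

lemma tokens_value_row_digits:
  assumes "set_mset T \<subseteq> squares m" and "\<forall>r<m. \<exists>d. row_represents T r d"
  shows "tokens_value T = (\<Sum>r<m. int (row_digit T r) * 10 ^ r)"
proof -
  \<comment> \<open>Being on the board matters here: no token escapes the sum over weights and rows
    below \<open>m\<close>.\<close>
  have "tokens_value T = (\<Sum>(b, r)\<in>weights \<times> {..<m}. int (count T (b, r)) * (int b * 10 ^ r))"
    unfolding tokens_value_def
    using assms(1) by (subst sum_mset_eq_sum_count[of "squares m"])
      (auto simp: squares_def intro!: sum.cong)
  also have "\<dots> = (\<Sum>r<m. \<Sum>b\<in>weights. int (count T (b, r)) * (int b * 10 ^ r))"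
    by (subst sum.swap) (simp add: sum.cartesian_product)
  also have "\<dots> = (\<Sum>r<m. int (\<Sum>b\<in>weights. count T (b, r) * b) * 10 ^ r)"
    by (simp add: sum_distrib_right mult.assoc)
  also have "\<dots> = (\<Sum>r<m. int (row_digit T r) * 10 ^ r)"
    using assms(2) row_represents_row_digit row_represents_value
    by (metis (no_types, lifting) lessThan_iff sum.cong)
  finally show ?thesis .
qed

lemma row_represents_empty: "row_represents {#} r 0"
  by (simp add: row_represents_def digit_weights_def)

lemma number_shown_eq_state_value:
  assumes "simple m st" and "on_board m st"
  shows "number_shown m st = state_value st"
proof -
  obtain c where c: "\<forall>c'. c' \<noteq> c \<longrightarrow> st c' = {#}" "\<forall>r<m. \<exists>d. row_represents (st c) r d"
    using assms(1) unfolding simple_def by blast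
  \<comment> \<open>An empty color shows digit 0 in every row, so the digit formula covers both
    colors at once.\<close>
  have "\<forall>r<m. \<exists>d. row_represents (st c') r d" for c'
    using c row_represents_empty by metis
  then have "tokens_value (st c') = (\<Sum>r<m. int (row_digit (st c') r) * 10 ^ r)" for c'
    using assms(2) tokens_value_row_digits unfolding on_board_def by blast
  \<comment> \<open>This matches the branches of \<open>number_shown\<close>: in each one the color
    not read is empty and contributes 0.\<close>
  moreover have "st Negative = {#} \<or> st Positive = {#}"
    using c(1) by (metis color.distinct(1))
  ultimately show ?thesis
    by (auto simp: number_shown_def state_value_def simp flip: \<open>\<And>c'. tokens_value (st c') = _\<close>)
qed

section \<open>Loading decimal numbers\<close>

lemma sum_decimal_digits: "(\<Sum>r<m. decimal_digit a r * 10 ^ r) = a mod 10 ^ m"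
proof (induction m)
  case (Suc m)
  \<comment> \<open>Splits off the top digit of the remainder.\<close>
  have "a mod 10 ^ Suc m = 10 ^ m * (a div 10 ^ m mod 10) + a mod 10 ^ m"
    using mod_mult2_eq[of a "10 ^ m" 10] by (simp add: mult.commute)
  then show ?case
    using Suc by (simp add: decimal_digit_def)
qed simp

lemma decimal_digit_le: "decimal_digit a r \<le> 9"
  using mod_less_divisor[of 10 "a div 10 ^ r"] unfolding decimal_digit_def by linarith

text \<open>Only the lowest \<open>m\<close> digits are loaded, hence the remainder; it is
  \<open>a\<close> itself when \<open>a\<close> is below 10^m.\<close>

lemma number_tokens_value: "tokens_value (number_tokens m a) = int (a mod 10 ^ m)"
proof -
  have "tokens_value (number_tokens m a) = (\<Sum>r<m. int (decimal_digit a r) * 10 ^ r)"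
    by (simp add: number_tokens_def tokens_value_sum tokens_value_mset_set_row
        finite_digit_weights sum_digit_weights decimal_digit_le del: of_nat_sum)
  also have "\<dots> = int (\<Sum>r<m. decimal_digit a r * 10 ^ r)"
    by simp
  finally show ?thesis
    by (simp only: sum_decimal_digits)
qed

lemma number_tokens_on_board: "set_mset (number_tokens m a) \<subseteq> squares m"
proof -
  have "set_mset (mset_set (digit_weights (decimal_digit a r) \<times> {r})) \<subseteq> squares m" if "r < m" for r
    using that digit_weights_subset[OF decimal_digit_le, of a r]
    by (auto simp: squares_def finite_digit_weights decimal_digit_le)
  then show ?thesis
    by (fastforce simp: number_tokens_def set_mset_sum)
qed

lemma load_on_board: "on_board m st \<Longrightarrow> on_board m (load m c a st)"
  using number_tokens_on_board by (auto simp: on_board_def load_def)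

lemma load_all_on_board: "on_board m st \<Longrightarrow> on_board m (load_all m ops st)"
  unfolding load_all_def by (induction ops arbitrary: st) (auto simp: load_on_board)

lemma load_all_value:
  "\<forall>(c, a)\<in>set ops. a < 10 ^ m
    \<Longrightarrow> state_value (load_all m ops st) = state_value st + (\<Sum>x\<leftarrow>ops. signed x)"
proof (induction ops arbitrary: st)
  case (Cons x ops)
  obtain c a where x: "x = (c, a)"
    by fastforce
  have "state_value (load m c a st) = state_value st + signed (c, a)"
    using Cons.prems x by (cases c) (simp_all add: state_value_def load_def number_tokens_value)
  then show ?case
    using Cons x by (simp add: load_all_def)
qed (simp add: load_all_def)


theorem theorem7:
  fixes m p s :: nat
    and a b :: "nat list"
    and ops :: "(color \<times> nat) list"
    and final :: state
  assumes "m \<ge> 1" and "p \<ge> 1" and "s \<ge> 1"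
    and "length a = p" and "length b = s"
    and "\<forall>x \<in> set a. x \<le> 10 ^ m - 1"
    and "\<forall>x \<in> set b. x \<le> 10 ^ m - 1"
    and "mset ops = mset (map (Pair Positive) a @ map (Pair Negative) b)"
    and "(movement m)\<^sup>*\<^sup>* (load_all m ops empty_state) final"
    and "simple m final"
  shows "number_shown m final = int (sum_list a) - int (sum_list b)"
proof -
  \<comment> \<open>The loading order is arbitrary: \<open>ops\<close> is known only as a multiset,
    which suffices for the sum.\<close>
  have "(\<Sum>x\<leftarrow>ops. signed x) = (\<Sum>x\<in>#mset ops. signed x)"
    by (metis mset_map sum_mset_sum_list)
  also have "\<dots> = int (sum_list a) - int (sum_list b)"
    unfolding assms(8)
    by (simp add: sum_mset_sum_list comp_def sum_list_int sum_list_uminus flip: mset_map)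
  finally have signed: "(\<Sum>x\<leftarrow>ops. signed x) = int (sum_list a) - int (sum_list b)" .
  have "set ops = set (map (Pair Positive) a @ map (Pair Negative) b)"
    using assms(8) by (metis set_mset_mset)
  \<comment> \<open>Subtraction on naturals truncates, so the strict bound relies on 10^m being
    positive.\<close>
  moreover have "x \<le> 10 ^ m - 1 \<Longrightarrow> x < 10 ^ m" for x :: nat
    using zero_less_power[of "10 :: nat" m] by linarith
  ultimately have "\<forall>(c, x)\<in>set ops. x < 10 ^ m"
    using assms(6,7) by auto
  then have loaded: "state_value (load_all m ops empty_state) = int (sum_list a) - int (sum_list b)"
    by (simp add: load_all_value signed) (simp add: state_value_def empty_state_def)
  have "on_board m (load_all m ops empty_state)"
    by (rule load_all_on_board) (simp add: on_board_def empty_state_def)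
  then have "on_board m final" "state_value final = int (sum_list a) - int (sum_list b)"
    using movements_invariant assms(9) loaded by auto
  then show ?thesis
    using number_shown_eq_state_value assms(10) by simp
qed

end
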